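(* For every rational number $k$, $$(496k^2+960k-16)^4+(-16k^2-992k-480)^4+(480k^2-32k-496)^4+(532^4+798^4+1330^4)(k^2+k+1)^4$$ $$=(342^4+336^4+224^4+560^4+950^4+1292^4)(k^2+k+1)^4 .$$
   Context: This is a one-parameter family of solutions of $a^4+b^4+c^4+d^4+e^4+f^4=p^4+q^4+r^4+s^4+t^4+u^4$; here $k$ is a free parameter. *)

theory Defs
  imports Complex_Main
begin

end

theory Submission
  imports Defs
begin

text \<open>
  The twelve terms fall into four triples of the shape \<open>x, y, x + y\<close>, up to the common factor
  \<open>k\<^sup>2 + k + 1\<close>. On such a triple the sum of fourth powers is \<open>2 N(x, y)\<^sup>2\<close>, where
  \<open>N(x, y) = x\<^sup>2 + x y + y\<^sup>2\<close>, so the claim reduces to two equalities between values of \<open>N\<close>.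

  The first is numerical, \<open>N(532, 798) = N(342, 950)\<close>, and it cancels one constant triple on
  each side. The second is between the triple that is quadratic in \<open>k\<close> and
  \<open>(224, 336, 560)\<close>. Here \<open>N(x, y)\<close> is the norm of \<open>x - y \<omega>\<close> for a primitive cube root of
  unity \<open>\<omega>\<close>, hence multiplicative, and if \<open>A, B\<close> are the first two entries of the quadratic
  triple, then \<open>A - B \<omega> = (496 + 16 \<omega>) (k - \<omega>\<^sup>2)\<^sup>2\<close>. As \<open>k - \<omega>\<^sup>2\<close> has norm
  \<open>k\<^sup>2 + k + 1\<close>, this gives \<open>N(A, B) = N(496, -16) (k\<^sup>2 + k + 1)\<^sup>2\<close>, and
  \<open>N(496, -16) = 238336 = N(224, 336)\<close>.
\<close>

definition eis_norm :: "'a::comm_ring_1 \<Rightarrow> 'a \<Rightarrow> 'a" where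
  "eis_norm x y = x^2 + x * y + y^2"

text \<open>
  Both sides are symmetric functions of \<open>x, y, -(x + y)\<close>. When the first elementary symmetric
  function vanishes, the fourth power sum is twice the square of the second one, which here is
  \<open>- eis_norm x y\<close>.
\<close>

lemma sum_fourth_powers_eq_eis_norm:
  fixes x y :: "'a::comm_ring_1"
  shows "x^4 + y^4 + (x + y)^4 = 2 * (eis_norm x y)^2"
  by (simp add: eis_norm_def power2_eq_square power4_eq_xxxx algebra_simps)

text \<open>
  The arguments on the left are the coordinates of \<open>(a - b \<omega>) (u - v \<omega>)\<close>, reduced with
  \<open>\<omega>\<^sup>2 = -1 - \<omega>\<close>.
\<close>

lemma eis_norm_mult:
  fixes a b u v :: "'a::comm_ring_1"
  shows "eis_norm (a * u - b * v) (a * v + b * u + b * v) = eis_norm a b * eis_norm u v"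
  by (simp add: eis_norm_def power2_eq_square power4_eq_xxxx algebra_simps)

lemma eis_norm_quadratic_family:
  fixes k :: "'a::comm_ring_1"
  shows "eis_norm (496 * k^2 + 960 * k - 16) (- 16 * k^2 - 992 * k - 480)
         = 238336 * (k^2 + k + 1)^2"
proof -
  \<comment> \<open>\<open>a - b \<omega>\<close> is the square of \<open>k - \<omega>\<^sup>2 = (k + 1) + \<omega>\<close>.\<close>
  define a where "a = (k + 1) * (k + 1) - (- 1) * (- 1)"
  define b where "b = (k + 1) * (- 1) + (- 1) * (k + 1) + (- 1) * (- 1)"
  have base: "eis_norm (k + 1) (- 1) = k^2 + k + 1"
    by (simp add: eis_norm_def power2_eq_square power4_eq_xxxx algebra_simps)
  have square: "eis_norm a b = (k^2 + k + 1)^2"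
    unfolding a_def b_def eis_norm_mult base by (simp add: power2_eq_square)
  have fst_coord: "496 * k^2 + 960 * k - 16 = a * 496 - b * (- 16)"
    by (simp add: a_def b_def power2_eq_square algebra_simps)
  have snd_coord: "- 16 * k^2 - 992 * k - 480 = a * (- 16) + b * 496 + b * (- 16)"
    by (simp add: a_def b_def power2_eq_square algebra_simps)
  have const: "eis_norm 496 (- 16 :: 'a) = 238336"
    by (simp add: eis_norm_def)
  show ?thesis
    unfolding fst_coord snd_coord eis_norm_mult square const by (simp add: mult.commute)
qed

theorem mainTheorem3:
  fixes k :: rat
  shows "(496 * k^2 + 960 * k - 16)^4 + (- 16 * k^2 - 992 * k - 480)^4 + (480 * k^2 - 32 * k - 496)^4
           + (532^4 + 798^4 + 1330^4) * (k^2 + k + 1)^4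
         = (342^4 + 336^4 + 224^4 + 560^4 + 950^4 + 1292^4) * (k^2 + k + 1)^4"
proof -
  define A where "A = 496 * k^2 + 960 * k - 16"
  define B where "B = - 16 * k^2 - 992 * k - 480"
  have C: "480 * k^2 - 32 * k - 496 = A + B"
    unfolding A_def B_def by simp
  have norm_AB: "eis_norm A B = 238336 * (k^2 + k + 1)^2"
    unfolding A_def B_def by (rule eis_norm_quadratic_family)
  have varying: "A^4 + B^4 + (A + B)^4 = (224^4 + 336^4 + 560^4) * (k^2 + k + 1)^4"
  proof -
    have "224^4 + 336^4 + 560^4 = 2 * (238336::rat)^2"
      using sum_fourth_powers_eq_eis_norm[of "224::rat" 336] by (simp add: eis_norm_def)
    then show ?thesis
      unfolding sum_fourth_powers_eq_eis_norm norm_AB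
      by (simp add: power_mult_distrib flip: power_mult)
  qed
  have const_triples: "532^4 + 798^4 + 1330^4 = (342^4 + 950^4 + 1292^4 :: rat)"
    using sum_fourth_powers_eq_eis_norm[of "532::rat" 798]
      sum_fourth_powers_eq_eis_norm[of "342::rat" 950]
    by (simp add: eis_norm_def)
  show ?thesis
    unfolding C A_def[symmetric] B_def[symmetric] varying const_triples
    by (simp add: distrib_right)
qed

end
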